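(* Let $p,d,d_0,L,M,n,n_1$ be positive integers with $d\le p$, $d_0\le p$ and $n_1\le n-1$. Fix deterministic data $(x_1,y_1),\ldots,(x_n,y_n)\in\mathbb{R}^p\times\mathbb{R}$, a probability distribution $Q$ on $\mathcal{Q}_{p\times d}:=\{A\in\mathbb{R}^{p\times d}:\mathrm{diag}(A^TA)=(1,\ldots,1)^T\}$, a base regression method $\hat g\in\mathcal{G}_{d,n_1}$, and a matrix $A_0\in\mathbb{R}^{p\times d_0}$ with $A_0^TA_0=I_{d_0\times d_0}$. Run the random projection ensemble procedure described in the context, producing $\hat\Pi$ and $\hat A_0^{L}$, and let $\Pi^\infty:=\mathbb{E}\bigl(\mathbf{P}_{\ell,*}\mathbf{P}_{\ell,*}^T\bigr)$ (which does not depend on $\ell$). Then \[ \mathbb{E}\, d_{\mathrm{F}}\bigl(\mathcal{S}(\hat A_0^{L}),\mathcal{S}(A_0)\bigr)\le 2d_0^{1/2}\bigl\|\Pi^\infty-A_0A_0^T\bigr\|_{\mathrm{op}}+\frac{2d_0^{1/2}(2\pi)^{1/2}p}{L^{1/2}}, \] where all expectations are taken only over the randomness of the projections and of the subsamples (the data being fixed).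
   Context: A $d$-dimensional regression method on $n_1$ points is a measurable function $\hat g:\mathbb{R}^d\times(\mathbb{R}^d\times\mathbb{R})^{n_1}\to\mathbb{R}$; $\mathcal{G}_{d,n_1}$ denotes the set of all such functions. The procedure (random projection ensemble dimension reduction) is: draw $\mathbf{P}_{1,1},\ldots,\mathbf{P}_{L,M}$ i.i.d. from $Q$. For each $\ell\in[L]$, draw (independently of everything else) a subset $\mathcal{N}_1\subseteq\{1,\ldots,n\}$ of size $n_1$ uniformly at random without replacement; for each $m\in[M]$ and $i\notin\mathcal{N}_1$ set $\hat h_{\ell,m}(x_i)=\hat g\bigl(\mathbf{P}_{\ell,m}^Tx_i;(\mathbf{P}_{\ell,m}^Tx_j,y_j)_{j\in\mathcal{N}_1}\bigr)$ and $\hat R_{\ell,m}=\sum_{i\notin\mathcal{N}_1}\{y_i-\hat h_{\ell,m}(x_i)\}^2$; let $\mathbf{P}_{\ell,*}:=\mathbf{P}_{\ell,m^*}$ where $m^*$ is the smallest index minimising $\hat R_{\ell,m}$ over $m\in[M]$. Set $\hat\Pi:=\frac1L\sum_{\ell=1}^L\mathbf{P}_{\ell,*}\mathbf{P}_{\ell,*}^T$, compute its singular value decomposition $\hat\Pi=UDU^T$ with singular values in decreasing order and $U=(U_1,\ldots,U_p)$ orthonormal, and let $\hat A_0^{L}:=(U_1,\ldots,U_{d_0})\in\mathbb{R}^{p\times d_0}$. For a matrix $A$, $\mathcal{S}(A)$ is the span of its columns. For $\hat A,A\in\mathbb{R}^{p\times d_0}$ with orthonormal columns, $d_{\mathrm{F}}^2(\mathcal{S}(\hat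 A),\mathcal{S}(A)):=\frac12\|\hat A\hat A^T-AA^T\|_F^2$. $\|\cdot\|_{\mathrm{op}}$ is the spectral norm and $\|\cdot\|_F$ the Frobenius norm. *)

theory Defs
  imports "HOL-Probability.Probability"
begin

text \<open>Matrices: a p x d matrix is an element of real^'d^'p (rows indexed by 'p).
  Data indices are 0..n-1; the j-th training point of a subsample N is the
  j-th smallest element of N.\<close>

definition Qpd :: "(real^'d^'p) set" where
  "Qpd = {A. \<forall>k. (transpose A ** A) $ k $ k = 1}"

definition subsamples :: "nat \<Rightarrow> nat \<Rightarrow> nat set set" where
  "subsamples n n1 = {N. N \<subseteq> {..<n} \<and> card N = n1}"

definition train ::
  "nat \<Rightarrow> (nat \<Rightarrow> real^'p) \<Rightarrow> (nat \<Rightarrow> real) \<Rightarrow> real^'d^'p \<Rightarrow> nat set \<Rightarrow> nat \<Rightarrow> (real^'d) \<times> real" where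
  "train n1 x y P N = (\<lambda>j\<in>{..<n1}. let k = sorted_list_of_set N ! j in (transpose P *v x k, y k))"

definition resid ::
  "nat \<Rightarrow> nat \<Rightarrow> (nat \<Rightarrow> real^'p) \<Rightarrow> (nat \<Rightarrow> real) \<Rightarrow>
   (real^'d \<Rightarrow> (nat \<Rightarrow> (real^'d) \<times> real) \<Rightarrow> real) \<Rightarrow> real^'d^'p \<Rightarrow> nat set \<Rightarrow> real" where
  "resid n n1 x y g P N =
     (\<Sum>i\<in>{..<n} - N. (y i - g (transpose P *v x i) (train n1 x y P N))\<^sup>2)"

definition Pstar ::
  "nat \<Rightarrow> nat \<Rightarrow> nat \<Rightarrow> (nat \<Rightarrow> real^'p) \<Rightarrow> (nat \<Rightarrow> real) \<Rightarrow>
   (real^'d \<Rightarrow> (nat \<Rightarrow> (real^'d) \<times> real) \<Rightarrow> real) \<Rightarrow> (nat \<Rightarrow> real^'d^'p) \<Rightarrow> nat set \<Rightarrow> real^'d^'p" where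
  "Pstar n n1 M x y g Pm N =
     Pm (LEAST m. m < M \<and> (\<forall>m'<M. resid n n1 x y g (Pm m) N \<le> resid n n1 x y g (Pm m') N))"

definition Pihat ::
  "nat \<Rightarrow> nat \<Rightarrow> nat \<Rightarrow> nat \<Rightarrow> (nat \<Rightarrow> real^'p) \<Rightarrow> (nat \<Rightarrow> real) \<Rightarrow>
   (real^'d \<Rightarrow> (nat \<Rightarrow> (real^'d) \<times> real) \<Rightarrow> real) \<Rightarrow>
   (nat \<times> nat \<Rightarrow> real^'d^'p) \<Rightarrow> (nat \<Rightarrow> nat set) \<Rightarrow> real^'p^'p" where
  "Pihat n n1 L M x y g Ps Ns =
     (1 / real L) *\<^sub>R (\<Sum>l<L. let P = Pstar n n1 M x y g (\<lambda>m. Ps (l, m)) (Ns l) in P ** transpose P)"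

definition is_svd :: "((real, 'p::{finite,linorder}) vec, 'p) vec \<Rightarrow> ((real,'p) vec,'p) vec \<Rightarrow> ((real,'p) vec,'p) vec \<Rightarrow> bool" where
  "is_svd S U D \<longleftrightarrow> orthogonal_matrix U \<and> S = U ** D ** transpose U \<and>
     (\<forall>i j. i \<noteq> j \<longrightarrow> D $ i $ j = 0) \<and> (\<forall>i. D $ i $ i \<ge> 0) \<and>
     (\<forall>i j. i \<le> j \<longrightarrow> D $ j $ j \<le> D $ i $ i)"

text \<open>Order-preserving map of 'd0 onto the first CARD('d0) indices of 'p.\<close>
definition colsel :: "'d0::{finite,linorder} \<Rightarrow> 'p::{finite,linorder}" where
  "colsel k = sorted_list_of_set (UNIV :: 'p set) ! card {j. j < k}"

definition firstcols :: "((real,'p) vec,'p) vec \<Rightarrow> ((real, 'd0::{finite,linorder}) vec, 'p::{finite,linorder}) vec" where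
  "firstcols U = (\<chi> r k. U $ r $ colsel k)"

definition dF :: "real^'d0^'p \<Rightarrow> real^'d0^'p \<Rightarrow> real" where
  "dF Ah A = sqrt (1/2 * (norm (Ah ** transpose Ah - A ** transpose A))\<^sup>2)"

definition opnorm :: "real^'n^'m \<Rightarrow> real" where
  "opnorm A = onorm (\<lambda>v. A *v v)"

end

(* Each projection P selected by the ensemble has ||P P^T||_F <= d, so the average Pihat of L
   independent copies of P P^T deviates from its mean PiInf by at most d / sqrt L in mean Frobenius
   norm, by the variance of a sum of independent terms; since 1 <= sqrt (2 pi) and d <= p, no matrix
   concentration inequality is needed. A Davis-Kahan bound, valid for every realisation of Pihat,
   turns the operator-norm distance of Pihat to the projection A0 A0^T, whose spectral gap is 1,
   into the subspace distance. *)

theory Submission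
  imports Defs
begin

text \<open>The subspace estimate is variational. The first d0 singular vectors of a positive
  semidefinite S maximise the pairing of S with projections of rank d0, so comparing that maximiser
  with A0 replaces any discussion of the spectrum of Pihat. The unit gap enters through one
  identity: for projections K, P of rank d0 at distance \<open>\<delta>\<close>, pairing K - P with
  P gives minus the square of \<open>\<delta>\<close>. The perturbation meets two residuals of
  Frobenius norm \<open>\<delta>\<close>; this produces the factor 2, and one
  \<open>\<delta>\<close> cancels.

  The singular basis is an arbitrary choice and may fail to be measurable. The bound is therefore
  proved at every sample point, with a measurable majorant to integrate. The sample space lists all
  projections by pairs (l, m) and all subsamples separately, so the L independent copies must first
  be recovered by regrouping coordinates. Within a block the selected index is random, so
  measurability of the selected projection also needs an argument.\<close>

subsection \<open>Perturbation of projections\<close>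

text \<open>On matrices \<open>\<bullet>\<close> is the trace form and \<open>norm\<close> the
  Frobenius norm. Moving factors across \<open>\<bullet>\<close> by adjointness takes the place of
  cyclicity of the trace.\<close>

lemma inner_matrix_transpose_mult:
  fixes A :: "real^'n^'m" and B :: "real^'k^'n" and C :: "real^'k^'m"
  shows "(A ** B) \<bullet> C = B \<bullet> (transpose A ** C)"
proof -
  have "(A ** B) \<bullet> C = (\<Sum>i\<in>UNIV. \<Sum>j\<in>UNIV. \<Sum>l\<in>UNIV. A$i$l * B$l$j * C$i$j)"
    by (simp add: inner_vec_def matrix_matrix_mult_def sum_distrib_right)
  also have "\<dots> = (\<Sum>i\<in>UNIV. \<Sum>l\<in>UNIV. \<Sum>j\<in>UNIV. A$i$l * B$l$j * C$i$j)"
    by (intro sum.cong refl sum.swap)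
  also have "\<dots> = (\<Sum>l\<in>UNIV. \<Sum>i\<in>UNIV. \<Sum>j\<in>UNIV. A$i$l * B$l$j * C$i$j)"
    by (rule sum.swap)
  also have "\<dots> = (\<Sum>l\<in>UNIV. \<Sum>j\<in>UNIV. \<Sum>i\<in>UNIV. A$i$l * B$l$j * C$i$j)"
    by (intro sum.cong refl sum.swap)
  also have "\<dots> = B \<bullet> (transpose A ** C)"
    by (simp add: inner_vec_def matrix_matrix_mult_def sum_distrib_left transpose_def mult_ac)
  finally show ?thesis .
qed

lemma inner_matrix_transpose: "transpose (A::real^'n^'m) \<bullet> transpose B = A \<bullet> B"
  unfolding inner_vec_def transpose_def by (simp, rule sum.swap)

lemma inner_matrix_mult_transpose:
  fixes A :: "real^'n^'m" and B :: "real^'k^'n" and C :: "real^'k^'m"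
  shows "(A ** B) \<bullet> C = A \<bullet> (C ** transpose B)"
proof -
  have "(A ** B) \<bullet> C = (transpose B ** transpose A) \<bullet> transpose C"
    by (simp add: inner_matrix_transpose flip: matrix_transpose_mul)
  also have "\<dots> = transpose A \<bullet> (B ** transpose C)"
    by (simp add: inner_matrix_transpose_mult)
  also have "B ** transpose C = transpose (C ** transpose B)"
    by (simp add: matrix_transpose_mul)
  finally show ?thesis by (simp add: inner_matrix_transpose)
qed

lemma matrix_diff_rdistrib: "(B - C) ** (A::real^'n^'m) = B ** A - C ** A"
  by (simp add: matrix_matrix_mult_def vec_eq_iff left_diff_distrib sum_subtractf)

lemma transpose_diff: "transpose (A - B :: real^'n^'m) = transpose A - transpose B"
  by (simp add: transpose_def vec_eq_iff)

lemma norm_matrix_columns: "(norm (A::real^'n^'m))\<^sup>2 = (\<Sum>k\<in>UNIV. (norm (column k A))\<^sup>2)"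
  unfolding power2_norm_eq_inner column_def inner_vec_def
  by (simp, rule sum.swap)

lemma orthonormal_columns_norm:
  fixes A :: "real^'n^'m"
  assumes "transpose A ** A = mat 1"
  shows "A \<bullet> A = real CARD('n)" "norm (column k A) = 1"
proof -
  have c: "column k A \<bullet> column k A = 1" for k
  proof -
    have "(transpose A ** A) $ k $ k = 1" by (simp add: assms mat_def)
    then show ?thesis by (simp add: matrix_matrix_mult_def transpose_def column_def inner_vec_def)
  qed
  then show "norm (column k A) = 1" by (simp add: norm_eq_sqrt_inner)
  show "A \<bullet> A = real CARD('n)"
    using norm_matrix_columns[of A] c by (simp add: power2_norm_eq_inner)
qed

section \<open>Operator norm against Frobenius norm\<close>

lemma opnorm_nonneg: "0 \<le> opnorm (A::real^'n^'m)"
  unfolding opnorm_def by (rule onorm_pos_le) simp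

lemma opnorm_triangle: "opnorm (A + B :: real^'n^'m) \<le> opnorm A + opnorm B"
  unfolding opnorm_def matrix_vector_mult_add_rdistrib by (rule onorm_triangle) simp_all

lemma norm_matrix_vector_mult_le: "norm ((A::real^'n^'m) *v v) \<le> norm A * norm v"
proof -
  have "(norm (A *v v))\<^sup>2 = (\<Sum>i\<in>UNIV. (A$i \<bullet> v)\<^sup>2)"
    unfolding power2_norm_eq_inner
    by (simp add: inner_vec_def matrix_vector_mult_def power2_eq_square)
  also have "\<dots> \<le> (\<Sum>i\<in>UNIV. (norm (A$i) * norm v)\<^sup>2)"
    by (intro sum_mono) (metis Cauchy_Schwarz_ineq2 abs_ge_zero power2_abs power_mono)
  also have "\<dots> = (norm A * norm v)\<^sup>2"
    by (simp add: power_mult_distrib power2_norm_eq_inner inner_vec_def[of A] flip: sum_distrib_right)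
  finally show ?thesis by (rule power2_le_imp_le) simp
qed

lemma opnorm_le_norm: "opnorm (A::real^'n^'m) \<le> norm A"
  unfolding opnorm_def by (rule onorm_le) (rule norm_matrix_vector_mult_le)

text \<open>The columns of \<open>E ** A\<close> are images of unit vectors, so each has norm at
  most \<open>opnorm E\<close>. Adding their squares is the origin of the factor sqrt d0 in the
  theorem.\<close>

lemma norm_mult_orthonormal_columns_le:
  fixes A :: "real^'n^'m" and E :: "real^'m^'m"
  assumes "transpose A ** A = mat 1"
  shows "norm (E ** A) \<le> sqrt (real CARD('n)) * opnorm E"
proof -
  have col: "norm (column k (E ** A)) \<le> opnorm E" for k
  proof -
    have "column k (E ** A) = E *v column k A"
      by (simp add: column_def matrix_matrix_mult_def matrix_vector_mult_def vec_eq_iff)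
    then show ?thesis
      using onorm[of "(*v) E" "column k A"] orthonormal_columns_norm(2)[OF assms, of k]
      by (simp add: opnorm_def)
  qed
  have "(norm (E ** A))\<^sup>2 \<le> (\<Sum>k\<in>(UNIV::'n set). (opnorm E)\<^sup>2)"
    unfolding norm_matrix_columns[of "E ** A"] by (intro sum_mono power_mono col) simp
  also have "\<dots> = (sqrt (real CARD('n)) * opnorm E)\<^sup>2"
    by (simp add: power_mult_distrib)
  finally show ?thesis by (rule power2_le_imp_le) (simp add: opnorm_nonneg)
qed

text \<open>The entries of \<open>P ** transpose P\<close> are inner products of rows, so
  Cauchy-Schwarz applies entry by entry. Columns of elements of \<open>Qpd\<close> are unit vectors
  but need not be orthogonal; if they all coincide, equality holds with value d.\<close>

lemma norm_mult_transpose_self_le: "norm ((P::real^'n^'m) ** transpose P) \<le> (norm P)\<^sup>2"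
proof -
  have "(norm (P ** transpose P))\<^sup>2 = (\<Sum>i\<in>UNIV. \<Sum>j\<in>UNIV. (P$i \<bullet> P$j)\<^sup>2)"
    unfolding power2_norm_eq_inner
    by (simp add: inner_vec_def matrix_matrix_mult_def transpose_def power2_eq_square)
  also have "\<dots> \<le> (\<Sum>i\<in>UNIV. \<Sum>j\<in>UNIV. (norm (P$i) * norm (P$j))\<^sup>2)"
    by (intro sum_mono) (metis Cauchy_Schwarz_ineq2 abs_ge_zero power2_abs power_mono)
  also have "\<dots> = ((norm P)\<^sup>2)\<^sup>2"
  proof -
    have n: "(norm P)\<^sup>2 = (\<Sum>i\<in>UNIV. (norm (P$i))\<^sup>2)"
      unfolding power2_norm_eq_inner by (simp add: inner_vec_def[of P P])
    show ?thesis
      unfolding n power2_eq_square[of "sum _ _"] sum_product power_mult_distrib ..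
  qed
  finally show ?thesis by (rule power2_le_imp_le) simp
qed

lemma Qpd_norm:
  fixes P :: "real^'d^'p"
  assumes "P \<in> Qpd"
  shows "(norm P)\<^sup>2 = real CARD('d)"
proof -
  have "(norm (column k P))\<^sup>2 = 1" for k
    using assms unfolding power2_norm_eq_inner
    by (simp add: Qpd_def matrix_matrix_mult_def transpose_def column_def inner_vec_def)
  then show ?thesis by (simp add: norm_matrix_columns[of P])
qed

text \<open>The difference of two projections decomposes as
  $K - P = K(I - P) - (I - K)P$; each summand factors through $d_0$ orthonormal columns, so
  pairing it with $E$ costs $\sqrt{d_0}\,\|E\|_{\mathrm{op}}$ instead of a Frobenius norm of $E$.\<close>

lemma projection_distance_le:
  fixes H A :: "real^'k^'p" and S :: "real^'p^'p"
  assumes H: "transpose H ** H = mat 1" and A: "transpose A ** A = mat 1"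
    and S: "transpose S = S"
    and opt: "(A ** transpose A) \<bullet> S \<le> (H ** transpose H) \<bullet> S"
  shows "dF H A \<le> 2 * sqrt (real CARD('k)) * opnorm (S - A ** transpose A)"
proof -
  define K P where defs: "K = H ** transpose H" "P = A ** transpose A"
  define E where "E = S - P"
  have tr [simp]: "transpose K = K" "transpose P = P"
    by (simp_all add: defs matrix_transpose_mul)
  have tE: "transpose E = E"
    using S by (simp add: E_def transpose_diff)
  have KH: "K ** H = H" and PA: "P ** A = A"
    using H A by (simp_all add: defs flip: matrix_mul_assoc)
  have KK: "K ** K = K" and PP: "P ** P = P"
    using KH PA by (simp_all add: defs matrix_mul_assoc)
  have X_K: "X \<bullet> K = (X ** H) \<bullet> H" and X_P: "X \<bullet> P = (X ** A) \<bullet> A" for X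
    by (simp_all add: defs inner_matrix_mult_transpose)
  have nK: "K \<bullet> K = real CARD('k)" and nP: "P \<bullet> P = real CARD('k)"
    using orthonormal_columns_norm(1)[OF H] orthonormal_columns_norm(1)[OF A]
    by (simp_all add: X_K X_P KH PA)
  define \<delta> where "\<delta> = dF H A"
  have \<delta>0: "0 \<le> \<delta>" by (simp add: \<delta>_def dF_def)
  have \<delta>2: "\<delta>\<^sup>2 = real CARD('k) - K \<bullet> P"
  proof -
    have "\<delta>\<^sup>2 = 1/2 * (norm (K - P))\<^sup>2"
      unfolding \<delta>_def dF_def defs[symmetric] by (rule real_sqrt_pow2) simp
    then show ?thesis
      unfolding power2_norm_eq_inner inner_diff_left inner_diff_right nK nP inner_commute[of P K]
      by simp
  qed
  \<comment> \<open>The part of \<open>H\<close> outside the range of \<open>P\<close> and the part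
    of \<open>A\<close> outside the range of \<open>K\<close> have the same size: as both ranks are
    d0, each squared norm is d0 - \<open>K \<bullet> P\<close>.\<close>
  have nH: "norm (H - P ** H) = \<delta>"
  proof -
    have "(norm (H - P ** H))\<^sup>2 = H \<bullet> H - 2 * ((P ** H) \<bullet> H) + H \<bullet> (P ** (P ** H))"
      unfolding power2_norm_eq_inner inner_diff_left inner_diff_right
      using inner_matrix_transpose_mult[of P H "P ** H"]
      by (simp add: inner_commute)
    also have "H \<bullet> (P ** (P ** H)) = (P ** H) \<bullet> H"
      by (simp add: matrix_mul_assoc PP inner_commute)
    also have "(P ** H) \<bullet> H = K \<bullet> P" by (metis X_K inner_commute)
    finally have "(norm (H - P ** H))\<^sup>2 = \<delta>\<^sup>2"
      using orthonormal_columns_norm(1)[OF H] by (simp add: \<delta>2)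
    with \<delta>0 show ?thesis by (simp add: power2_eq_iff_nonneg)
  qed
  have nA: "norm (A - K ** A) = \<delta>"
  proof -
    have "(norm (A - K ** A))\<^sup>2 = A \<bullet> A - 2 * ((K ** A) \<bullet> A) + A \<bullet> (K ** (K ** A))"
      unfolding power2_norm_eq_inner inner_diff_left inner_diff_right
      using inner_matrix_transpose_mult[of K A "K ** A"]
      by (simp add: inner_commute)
    also have "A \<bullet> (K ** (K ** A)) = (K ** A) \<bullet> A"
      by (simp add: matrix_mul_assoc KK inner_commute)
    also have "(K ** A) \<bullet> A = K \<bullet> P" by (metis X_P)
    finally have "(norm (A - K ** A))\<^sup>2 = \<delta>\<^sup>2"
      using orthonormal_columns_norm(1)[OF A] by (simp add: \<delta>2)
    with \<delta>0 show ?thesis by (simp add: power2_eq_iff_nonneg)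
  qed
  \<comment> \<open>Inserting \<open>P ** K\<close> leaves one residual in each difference. In the
    second it stands on the right, and symmetry of \<open>E\<close> permits transposing it.\<close>
  have "(K - P) \<bullet> E = (K - P ** K) \<bullet> E - (P - P ** K) \<bullet> E"
    by (simp add: inner_diff_left)
  also have "(K - P ** K) \<bullet> E = (H - P ** H) \<bullet> (E ** H)"
  proof -
    have "K - P ** K = (H - P ** H) ** transpose H"
      by (simp add: defs matrix_diff_rdistrib matrix_mul_assoc)
    then show ?thesis by (simp add: inner_matrix_mult_transpose)
  qed
  also have "(P - P ** K) \<bullet> E = (A - K ** A) \<bullet> (E ** A)"
  proof -
    have "P - P ** K = transpose (P - K ** P)"
      by (simp add: transpose_diff matrix_transpose_mul)
    then have "(P - P ** K) \<bullet> E = (P - K ** P) \<bullet> E"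
      by (metis inner_matrix_transpose tE)
    moreover have "P - K ** P = (A - K ** A) ** transpose A"
      by (simp add: defs matrix_diff_rdistrib matrix_mul_assoc)
    ultimately show ?thesis by (simp add: inner_matrix_mult_transpose)
  qed
  also have "(H - P ** H) \<bullet> (E ** H) - (A - K ** A) \<bullet> (E ** A)
      \<le> \<delta> * norm (E ** H) + \<delta> * norm (E ** A)"
    using norm_cauchy_schwarz[of "H - P ** H" "E ** H"]
      norm_cauchy_schwarz[of "- (A - K ** A)" "E ** A"]
    unfolding norm_minus_cancel nH nA inner_minus_left by linarith
  also have "\<dots> \<le> \<delta> * (sqrt (real CARD('k)) * opnorm E) + \<delta> * (sqrt (real CARD('k)) * opnorm E)"
    by (intro add_mono mult_left_mono norm_mult_orthonormal_columns_le H A \<delta>0)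
  finally have "(K - P) \<bullet> E \<le> \<delta> * (2 * sqrt (real CARD('k)) * opnorm E)"
    by (simp add: mult_ac)
  \<comment> \<open>The unit spectral gap: \<open>opt\<close> makes the pairing of
    \<open>K - P\<close> with \<open>S\<close> nonnegative, and subtracting the pairing with
    \<open>P\<close> adds exactly d0 - \<open>K \<bullet> P\<close>.\<close>
  moreover have "\<delta>\<^sup>2 \<le> (K - P) \<bullet> E"
    using opt unfolding defs[symmetric] E_def \<delta>2 by (simp add: inner_diff_left inner_diff_right nP)
  ultimately have "\<delta> * \<delta> \<le> \<delta> * (2 * sqrt (real CARD('k)) * opnorm E)"
    by (simp add: power2_eq_square)
  then show ?thesis
    using \<delta>0 unfolding \<delta>_def[symmetric] defs[symmetric] E_def[symmetric]
    by (cases "\<delta> = 0") (auto simp: opnorm_nonneg)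
qed


section \<open>Leading columns and Ky Fan's principle\<close>

lemma card_less_less_card:
  fixes k :: "'a::{finite,linorder}"
  shows "card {j. j < k} < CARD('a)"
  by (rule psubset_card_mono) auto

lemma image_card_less:
  "(\<lambda>k. card {j. j < k}) ` (UNIV :: 'a::{finite,linorder} set) = {..<CARD('a)}"
proof (rule card_subset_eq)
  have "inj (\<lambda>k::'a. card {j. j < k})"
  proof (rule linorder_injI)
    fix a b :: 'a
    assume "a < b"
    then have "{j. j < a} \<subset> {j. j < b}" by auto
    then have "card {j. j < a} < card {j. j < b}" by (intro psubset_card_mono) auto
    then show "card {j. j < a} \<noteq> card {j. j < b}" by simp
  qed
  then show "card (range (\<lambda>k::'a. card {j. j < k})) = card {..<CARD('a)}"
    by (simp add: card_image)
qed (auto simp: card_less_less_card)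

text \<open>Ranks in \<open>'k\<close> fill exactly the positions below \<open>CARD('k)\<close> in
  the sorted list of \<open>'p\<close>, so an index outside the range sits at a later position. This
  is what lets the order of the singular values be used.\<close>

lemma
  assumes "CARD('k::{finite,linorder}) \<le> CARD('p::{finite,linorder})"
  shows inj_colsel: "inj (colsel :: 'k \<Rightarrow> 'p)"
    and colsel_le: "\<And>i k. i \<notin> range (colsel :: 'k \<Rightarrow> 'p) \<Longrightarrow> (colsel (k::'k) :: 'p) \<le> i"
proof -
  define xs where "xs = sorted_list_of_set (UNIV :: 'p set)"
  have xs: "length xs = CARD('p)" "distinct xs" "sorted xs" "set xs = UNIV"
    by (simp_all add: xs_def)
  have rank: "card {j. j < k} < CARD('p)" for k :: 'k
    using card_less_less_card[of k] assms by linarith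
  have cs: "(colsel (k::'k) :: 'p) = xs ! card {j. j < k}" for k
    by (simp add: colsel_def xs_def)
  show "inj (colsel :: 'k \<Rightarrow> 'p)"
  proof (rule injI)
    fix a b :: 'k
    assume "(colsel a :: 'p) = colsel b"
    then have "card {j. j < a} = card {j. j < b}"
      using rank xs by (simp add: cs nth_eq_iff_index_eq)
    moreover have "inj (\<lambda>k::'k. card {j. j < k})"
      by (rule eq_card_imp_inj_on) (simp_all add: image_card_less)
    ultimately show "a = b" by (auto dest: injD)
  qed
  fix i :: 'p and k :: 'k
  assume i: "i \<notin> range (colsel :: 'k \<Rightarrow> 'p)"
  obtain m where m: "m < CARD('p)" "xs ! m = i"
    using xs by (metis UNIV_I in_set_conv_nth)
  have "\<not> m < CARD('k)"
  proof
    assume "m < CARD('k)"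
    then have "m \<in> range (\<lambda>k::'k. card {j. j < k})" by (simp add: image_card_less)
    then obtain k' :: 'k where "m = card {j. j < k'}" by blast
    then have "colsel k' = i" using m cs by simp
    with i show False by blast
  qed
  then have "card {j. j < k} \<le> m" using card_less_less_card[of k] by linarith
  then show "colsel k \<le> i"
    using m xs by (simp add: cs sorted_nth_mono flip: m(2))
qed

text \<open>Ky Fan's argument: in the singular basis both traces weight the diagonal of $D$ with weights in
  $[0,1]$ of total mass $d_0$, and $H$ puts all of it on the $d_0$ largest entries.\<close>

lemma firstcols_svd:
  fixes S U D :: "((real, 'p::{finite,linorder}) vec, 'p) vec"
    and A H :: "((real, 'k::{finite,linorder}) vec, 'p) vec"
  assumes le: "CARD('k) \<le> CARD('p)"
    and svd: "is_svd S U D" and A: "transpose A ** A = mat 1" and H: "H = firstcols U"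
  shows "transpose H ** H = mat 1"
    and "(A ** transpose A) \<bullet> S \<le> (H ** transpose H) \<bullet> S"
proof -
  have U: "transpose U ** U = mat 1" "U ** transpose U = mat 1"
    and S: "S = U ** D ** transpose U"
    and D: "\<And>i j. i \<noteq> j \<Longrightarrow> D $ i $ j = 0" "\<And>i j. i \<le> j \<Longrightarrow> D $ j $ j \<le> D $ i $ i"
    using svd by (auto simp: is_svd_def orthogonal_matrix_def)
  have inj: "inj (colsel :: 'k \<Rightarrow> 'p)" by (rule inj_colsel[OF le])
  have UU: "(\<Sum>r\<in>UNIV. U $ r $ i * U $ r $ j) = (if i = j then 1 else 0)" for i j
  proof -
    have "(transpose U ** U) $ i $ j = (if i = j then 1 else 0)" by (simp add: U mat_def)
    then show ?thesis by (simp add: matrix_matrix_mult_def transpose_def)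
  qed
  show tHH: "transpose H ** H = mat 1"
    using inj by (simp add: H firstcols_def matrix_matrix_mult_def transpose_def mat_def
        vec_eq_iff UU inj_eq)
  \<comment> \<open>Conjugation by \<open>U\<close> turns the pairing into one with a diagonal
    matrix, which sees only the diagonal of \<open>G ** transpose G\<close>, the squared row norms
    of \<open>G\<close>.\<close>
  have weights: "(X ** transpose X) \<bullet> S = (\<Sum>i\<in>UNIV. D $ i $ i * (norm ((transpose U ** X) $ i))\<^sup>2)"
    for X :: "((real, 'k) vec, 'p) vec"
  proof -
    define G where "G = transpose U ** X"
    have "(X ** transpose X) \<bullet> S = (U ** D) \<bullet> ((X ** transpose X) ** U)"
      unfolding S inner_commute[of "X ** transpose X"]
      by (simp add: inner_matrix_mult_transpose)
    also have "\<dots> = D \<bullet> (G ** transpose G)"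
      by (simp add: inner_matrix_transpose_mult G_def matrix_transpose_mul matrix_mul_assoc)
    also have "\<dots> = (\<Sum>i\<in>UNIV. \<Sum>j\<in>UNIV. if j = i then D $ i $ i * (norm (G $ i))\<^sup>2 else 0)"
      unfolding inner_vec_def[of D]
    proof (intro sum.cong refl)
      fix i
      show "D $ i \<bullet> (G ** transpose G) $ i = (\<Sum>j\<in>UNIV. if j = i then D $ i $ i * (norm (G $ i))\<^sup>2 else 0)"
        unfolding inner_vec_def[of "D $ i"]
        by (intro sum.cong refl)
          (auto simp: D power2_norm_eq_inner matrix_matrix_mult_def transpose_def inner_vec_def)
    qed
    finally show ?thesis by (simp add: G_def)
  qed
  define w where "w i = (norm ((transpose U ** A) $ i))\<^sup>2" for i
  define J where "J = range (colsel :: 'k \<Rightarrow> 'p)"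
  have wH: "(norm ((transpose U ** H) $ i))\<^sup>2 = indicator J i" for i
  proof -
    have "(transpose U ** H) $ i $ k = indicator {colsel k} i" for k
      by (simp add: matrix_matrix_mult_def transpose_def H firstcols_def UU)
    then have "(norm ((transpose U ** H) $ i))\<^sup>2 = (\<Sum>k\<in>UNIV. indicator {colsel (k::'k)} i)"
      unfolding power2_norm_eq_inner by (simp add: inner_vec_def indicator_def)
    also have "\<dots> = (\<Sum>j\<in>J. indicator {j} i)"
      unfolding J_def using inj by (simp add: sum.reindex)
    also have "\<dots> = indicator J i"
      by (simp add: indicator_def sum.delta' flip: of_bool_def)
    finally show ?thesis .
  qed
  have sumw: "(\<Sum>i\<in>UNIV. w i) = real CARD('k)"
  proof -
    have "(\<Sum>i\<in>UNIV. w i) = (transpose U ** A) \<bullet> (transpose U ** A)"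
      by (simp add: w_def power2_norm_eq_inner inner_vec_def[of "transpose U ** A"])
    also have "\<dots> = A \<bullet> A"
      by (simp add: inner_matrix_transpose_mult matrix_mul_assoc U)
    finally show ?thesis using orthonormal_columns_norm(1)[OF A] by simp
  qed
  \<comment> \<open>With u the unit vector \<open>column i U\<close>, \<open>A *v a\<close> is the
    orthogonal projection of u onto the column space of \<open>A\<close>, and \<open>A\<close>
    preserves norms. Hence the square of \<open>norm a\<close> is the inner product of u with
    \<open>A *v a\<close>, at most \<open>norm a\<close>.\<close>
  have w1: "w i \<le> 1" for i
  proof -
    define a where "a = (transpose U ** A) $ i"
    have a: "a = transpose A *v column i U"
      by (simp add: a_def vec_eq_iff matrix_matrix_mult_def matrix_vector_mult_def transpose_def
          column_def mult.commute)
    have "norm (A *v a) = norm a"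
    proof -
      have "(A *v a) \<bullet> (A *v a) = a \<bullet> (transpose A *v (A *v a))"
        by (metis dot_lmul_matrix inner_commute transpose_matrix_vector transpose_transpose)
      then show ?thesis by (simp add: matrix_vector_mul_assoc A norm_eq_sqrt_inner)
    qed
    moreover have "a \<bullet> a = column i U \<bullet> (A *v a)"
      by (metis a dot_lmul_matrix transpose_matrix_vector)
    moreover have "norm (column i U) = 1" by (rule orthonormal_columns_norm(2)[OF U(1)])
    ultimately have "(norm a)\<^sup>2 \<le> norm a"
      using norm_cauchy_schwarz[of "column i U" "A *v a"] by (simp add: power2_norm_eq_inner)
    then have "norm a \<le> 1"
      by (cases "norm a = 0") (auto simp: power2_eq_square)
    then show ?thesis by (simp add: w_def a_def[symmetric] power_le_one)
  qed
  \<comment> \<open>The smallest selected singular value is the threshold. Both weights have total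
    mass d0, so shifting all singular values by \<open>c\<close> changes nothing, and then both
    factors are nonnegative on \<open>J\<close> and nonpositive off \<open>J\<close>.\<close>
  define c where "c = Min ((\<lambda>j. D $ j $ j) ` J)"
  have J: "J \<noteq> {}" "finite J" by (auto simp: J_def)
  have "0 = c * (\<Sum>i\<in>UNIV. indicator J i - w i)"
    using inj by (simp add: sum_subtractf sumw J_def card_image sum.If_cases indicator_def)
  also have "\<dots> = (\<Sum>i\<in>UNIV. c * (indicator J i - w i))"
    by (rule sum_distrib_left)
  also have "\<dots> \<le> (\<Sum>i\<in>UNIV. D $ i $ i * (indicator J i - w i))"
  proof (rule sum_mono)
    fix i
    show "c * (indicator J i - w i) \<le> D $ i $ i * (indicator J i - w i)"
    proof (cases "i \<in> J")
      case True
      then have "c \<le> D $ i $ i" using J by (auto simp: c_def)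
      then show ?thesis using True w1[of i] by (simp add: mult_right_mono)
    next
      case False
      have "D $ i $ i \<le> c"
        using J False D(2) colsel_le[OF le] by (auto simp: c_def J_def)
      moreover have "0 \<le> w i" by (simp add: w_def)
      ultimately show ?thesis using False by (simp add: mult_right_mono)
    qed
  qed
  also have "\<dots> = (H ** transpose H) \<bullet> S - (A ** transpose A) \<bullet> S"
    unfolding weights wH w_def[symmetric] by (simp add: right_diff_distrib sum_subtractf)
  finally show "(A ** transpose A) \<bullet> S \<le> (H ** transpose H) \<bullet> S" by simp
qed

subsection \<open>Regrouping product measures and the variance bound\<close>

lemma indep_vars_PiM_coordinate:
  assumes "\<And>i. i \<in> I \<Longrightarrow> prob_space (M i)" "finite I"
  shows "prob_space.indep_vars (PiM I M) M (\<lambda>i \<omega>. \<omega> i) I"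
proof (cases "I = {}")
  case False
  interpret prob_space "PiM I M" by (rule prob_space_PiM) (use assms in auto)
  have "distr (PiM I M) (PiM I M) (\<lambda>\<omega>. \<lambda>i\<in>I. \<omega> i) = distr (PiM I M) (PiM I M) (\<lambda>\<omega>. \<omega>)"
    by (intro distr_cong) (auto simp: space_PiM PiE_def extensional_restrict)
  also have "\<dots> = PiM I (\<lambda>i. distr (PiM I M) (M i) (\<lambda>\<omega>. \<omega> i))"
    using assms by (auto simp: distr_id intro!: PiM_cong simp flip: distr_PiM_component)
  finally show ?thesis
    using False by (subst indep_vars_iff_distr_eq_PiM') auto
next
  case True
  interpret prob_space "PiM I M" by (rule prob_space_PiM) (use assms in auto)
  show ?thesis
    unfolding indep_vars_def indep_sets_def using True by auto
qed

text \<open>Supplies the i.i.d. structure: \<open>T\<close> gathers the M projections and the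
  subsample of each l into one block. Equality of measures is tested on boxes, where Fubini
  integrates out the subsamples and independence of disjoint coordinate blocks factors the
  rest.\<close>

lemma distr_PiM_blocks:
  fixes Q :: "'a measure" and N :: "'b measure"
  assumes Q: "prob_space Q" and N: "prob_space N"
    and fin: "finite I" "finite J"
  defines "\<Omega> \<equiv> PiM (I \<times> J) (\<lambda>_. Q) \<Otimes>\<^sub>M PiM I (\<lambda>_. N)"
    and "T \<equiv> \<lambda>\<omega>. \<lambda>l\<in>I. (\<lambda>m\<in>J. fst \<omega> (l, m), snd \<omega> l)"
  shows "T \<in> \<Omega> \<rightarrow>\<^sub>M PiM I (\<lambda>_. PiM J (\<lambda>_. Q) \<Otimes>\<^sub>M N)"
    and "distr \<Omega> (PiM I (\<lambda>_. PiM J (\<lambda>_. Q) \<Otimes>\<^sub>M N)) T = PiM I (\<lambda>_. PiM J (\<lambda>_. Q) \<Otimes>\<^sub>M N)"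
proof -
  interpret Q: prob_space Q by fact
  interpret N: prob_space N by fact
  interpret QJ: prob_space "PiM J (\<lambda>_. Q)" by (intro prob_space_PiM Q)
  interpret QIJ: prob_space "PiM (I \<times> J) (\<lambda>_. Q)" by (intro prob_space_PiM Q)
  interpret NI: prob_space "PiM I (\<lambda>_. N)" by (intro prob_space_PiM N)
  interpret W: pair_prob_space "PiM J (\<lambda>_. Q)" N ..
  interpret \<Omega>: pair_prob_space "PiM (I \<times> J) (\<lambda>_. Q)" "PiM I (\<lambda>_. N)" ..
  interpret PN: product_sigma_finite "\<lambda>_. N" ..
  interpret PW: product_sigma_finite "\<lambda>_. PiM J (\<lambda>_. Q) \<Otimes>\<^sub>M N" ..
  let ?W = "PiM J (\<lambda>_. Q) \<Otimes>\<^sub>M N"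
  have block[measurable]: "(\<lambda>p. \<lambda>m\<in>J. p (l, m)) \<in> PiM (I \<times> J) (\<lambda>_. Q) \<rightarrow>\<^sub>M PiM J (\<lambda>_. Q)"
    if "l \<in> I" for l
    using that by (intro measurable_restrict measurable_component_singleton) auto
  show T[measurable]: "T \<in> \<Omega> \<rightarrow>\<^sub>M PiM I (\<lambda>_. ?W)"
    unfolding T_def \<Omega>_def by measurable
  show "distr \<Omega> (PiM I (\<lambda>_. ?W)) T = PiM I (\<lambda>_. ?W)"
  proof (rule PW.PiM_eqI)
    fix A assume A[measurable]: "\<And>l. l \<in> I \<Longrightarrow> A l \<in> sets ?W"
    \<comment> \<open>The \<open>N\<close>-measure of the section of \<open>A l\<close> at
      \<open>q\<close>: what remains of the l-th factor once the subsample is integrated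
      out.\<close>
    define k where "k l q = (\<integral>\<^sup>+ s. indicator (A l) (q, s) \<partial>N)" for l q
    have k[measurable]: "k l \<in> borel_measurable (PiM J (\<lambda>_. Q))" if "l \<in> I" for l
      unfolding k_def using that by measurable
    have "emeasure (distr \<Omega> (PiM I (\<lambda>_. ?W)) T) (Pi\<^sub>E I A)
        = (\<integral>\<^sup>+ \<omega>. indicator (Pi\<^sub>E I A) (T \<omega>) \<partial>\<Omega>)"
    proof -
      have [measurable]: "Pi\<^sub>E I A \<in> sets (PiM I (\<lambda>_. ?W))"
        using fin A by (intro sets_PiM_I_finite) auto
      show ?thesis
        by (simp add: nn_integral_distr flip: nn_integral_indicator)
    qed
    also have "\<dots> = (\<integral>\<^sup>+ \<omega>. (\<Prod>l\<in>I. indicator (A l) (\<lambda>m\<in>J. fst \<omega> (l, m), snd \<omega> l)) \<partial>\<Omega>)"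
    proof (rule nn_integral_cong)
      fix \<omega>
      show "indicator (Pi\<^sub>E I A) (T \<omega>) =
          (\<Prod>l\<in>I. indicator (A l) (\<lambda>m\<in>J. fst \<omega> (l, m), snd \<omega> l) :: ennreal)"
        using fin unfolding indicator_def T_def
        by (auto simp: PiE_iff prod_zero_iff[OF fin(1)] intro!: prod.neutral[symmetric])
    qed
    also have "\<dots> = (\<integral>\<^sup>+ p. \<integral>\<^sup>+ s. (\<Prod>l\<in>I. indicator (A l) (\<lambda>m\<in>J. p (l, m), s l))
        \<partial>PiM I (\<lambda>_. N) \<partial>PiM (I \<times> J) (\<lambda>_. Q))"
      unfolding \<Omega>_def by (subst NI.nn_integral_fst[symmetric]) (auto intro!: borel_measurable_prod_ennreal)
    also have "\<dots> = (\<integral>\<^sup>+ p. (\<Prod>l\<in>I. k l (\<lambda>m\<in>J. p (l, m))) \<partial>PiM (I \<times> J) (\<lambda>_. Q))"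
    proof (rule nn_integral_cong)
      fix p assume "p \<in> space (PiM (I \<times> J) (\<lambda>_. Q))"
      then have p: "(\<lambda>m\<in>J. p (l, m)) \<in> space (PiM J (\<lambda>_. Q))" if "l \<in> I" for l
        using that by (auto simp: space_PiM PiE_iff)
      show "(\<integral>\<^sup>+ s. (\<Prod>l\<in>I. indicator (A l) (\<lambda>m\<in>J. p (l, m), s l)) \<partial>PiM I (\<lambda>_. N))
          = (\<Prod>l\<in>I. k l (\<lambda>m\<in>J. p (l, m)))"
        unfolding k_def using p
        by (intro PN.product_nn_integral_prod[OF fin(1),
              of "\<lambda>l s. indicator (A l) (\<lambda>m\<in>J. p (l, m), s)"]) measurable
    qed
    also have "\<dots> = (\<Prod>l\<in>I. \<integral>\<^sup>+ p. k l (\<lambda>m\<in>J. p (l, m)) \<partial>PiM (I \<times> J) (\<lambda>_. Q))"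
    proof (rule QIJ.indep_vars_nn_integral[OF fin(1)])
      \<comment> \<open>The l-th factor reads only coordinates in \<open>{l} \<times> J\<close>, and
        these sets are disjoint for different l.\<close>
      have "QIJ.indep_vars (\<lambda>l. PiM ({l} \<times> J) (\<lambda>_. Q)) (\<lambda>l p. restrict (\<lambda>i. p i) ({l} \<times> J)) I"
        by (rule QIJ.indep_vars_restrict[OF indep_vars_PiM_coordinate])
          (use fin Q in \<open>auto simp: disjoint_family_on_def\<close>)
      then have "QIJ.indep_vars (\<lambda>_. borel)
          (\<lambda>l p. k l (\<lambda>m\<in>J. restrict (\<lambda>i. p i) ({l} \<times> J) (l, m))) I"
        by (rule QIJ.indep_vars_compose2[where Y = "\<lambda>l p. k l (\<lambda>m\<in>J. p (l, m))"]) measurable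
      then show "QIJ.indep_vars (\<lambda>_. borel) (\<lambda>l p. k l (\<lambda>m\<in>J. p (l, m))) I"
        by (simp cong: restrict_cong)
    qed simp
    also have "\<dots> = (\<Prod>l\<in>I. emeasure ?W (A l))"
    proof (rule prod.cong[OF refl])
      fix l assume l: "l \<in> I"
      have "distr (PiM (I \<times> J) (\<lambda>_. Q)) (PiM J (\<lambda>_. Q)) (\<lambda>p. \<lambda>m\<in>J. p (l, m)) = PiM J (\<lambda>_. Q)"
        by (rule distr_PiM_reindex[where K = "I \<times> J" and M = "\<lambda>_. Q" and f = "\<lambda>m. (l, m)"])
          (use l Q in \<open>auto intro: inj_onI\<close>)
      then have "(\<integral>\<^sup>+ p. k l (\<lambda>m\<in>J. p (l, m)) \<partial>PiM (I \<times> J) (\<lambda>_. Q)) = (\<integral>\<^sup>+ q. k l q \<partial>PiM J (\<lambda>_. Q))"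
        using nn_integral_distr[OF block[OF l], of "k l"] k[OF l] by simp
      also have "\<dots> = emeasure ?W (A l)"
        unfolding k_def using l by (simp add: N.nn_integral_fst)
      finally show "(\<integral>\<^sup>+ p. k l (\<lambda>m\<in>J. p (l, m)) \<partial>PiM (I \<times> J) (\<lambda>_. Q)) = emeasure ?W (A l)" .
    qed
    finally show "emeasure (distr \<Omega> (PiM I (\<lambda>_. ?W)) T) (Pi\<^sub>E I A) = (\<Prod>l\<in>I. emeasure ?W (A l))" .
  qed (use fin in auto)
qed

text \<open>Pairings of distinct centred copies vanish in mean, so only the \<open>L\<close>
  diagonal terms survive in the squared norm, against a factor 1/L^2. Each is at most C^2 because
  centring does not increase the second moment.\<close>

lemma expected_norm_mean_deviation_le:
  fixes f :: "'w \<Rightarrow> 'a::euclidean_space"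
  assumes W: "prob_space W" and f[measurable]: "f \<in> borel_measurable W"
    and bound: "AE w in W. norm (f w) \<le> C" and L: "0 < L"
  defines "\<mu> \<equiv> (\<integral>w. f w \<partial>W)"
  defines "V \<equiv> PiM {..<L} (\<lambda>_. W)"
  shows "integrable V (\<lambda>w. norm ((1 / real L) *\<^sub>R (\<Sum>l<L. f (w l)) - \<mu>))" (is "integrable V (\<lambda>w. norm (?Z w))")
    and "(\<integral>w. norm ((1 / real L) *\<^sub>R (\<Sum>l<L. f (w l)) - \<mu>) \<partial>V) \<le> C / sqrt (real L)"
proof -
  interpret W: prob_space W by fact
  interpret V: prob_space V unfolding V_def by (intro prob_space_PiM W)
  interpret P: product_sigma_finite "\<lambda>_. W" ..
  have C: "0 \<le> C"
  proof -
    have "AE w in W. 0 \<le> C" using bound by eventually_elim (meson norm_ge_zero order_trans)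
    then show ?thesis by simp
  qed
  have intf: "integrable W f" using bound by (rule W.integrable_const_bound) measurable
  have [measurable]: "(\<lambda>w. w l) \<in> V \<rightarrow>\<^sub>M W" if "l < L" for l
    unfolding V_def using that by (intro measurable_component_singleton) auto
  have comp: "distr V W (\<lambda>w. w l) = W" if "l < L" for l
    unfolding V_def using that W by (subst distr_PiM_component) auto
  define h where "h w = f w - \<mu>" for w
  have h[measurable]: "h \<in> borel_measurable W" unfolding h_def by measurable
  have hb: "AE w in W. norm (h w) \<le> C + norm \<mu>"
    using bound by eventually_elim (unfold h_def, metis add_right_mono norm_triangle_ineq4 order_trans)
  have hV: "AE w in V. norm (h (w l)) \<le> C + norm \<mu>" if "l < L" for l
    unfolding V_def using that by (intro AE_PiM_component W hb) auto
  have inth: "integrable W h" unfolding h_def using intf by simp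
  have inth2: "integrable W (\<lambda>w. (norm (h w))\<^sup>2)"
    using hb by (intro W.integrable_const_bound[where B="(C + norm \<mu>)\<^sup>2"])
      (auto elim!: eventually_mono intro: power_mono)
  have Eh: "(\<integral>w. h w \<partial>W) = 0"
    unfolding h_def \<mu>_def using intf by (simp add: W.prob_space)
  have Eh2: "(\<integral>w. (norm (h w))\<^sup>2 \<partial>W) \<le> C\<^sup>2"
  proof -
    have if2: "integrable W (\<lambda>w. (norm (f w))\<^sup>2)"
      using bound by (intro W.integrable_const_bound[where B="C\<^sup>2"])
        (auto elim!: eventually_mono intro: power_mono)
    have "(\<integral>w. (norm (h w))\<^sup>2 \<partial>W) = (\<integral>w. (norm (f w))\<^sup>2 - 2 * (f w \<bullet> \<mu>) + (norm \<mu>)\<^sup>2 \<partial>W)"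
      by (simp add: h_def power2_norm_eq_inner algebra_simps inner_commute)
    also have "\<dots> = (\<integral>w. (norm (f w))\<^sup>2 \<partial>W) - 2 * (\<mu> \<bullet> \<mu>) + (norm \<mu>)\<^sup>2"
      using intf if2 by (simp add: \<mu>_def W.prob_space)
    also have "\<dots> \<le> (\<integral>w. (norm (f w))\<^sup>2 \<partial>W)"
      by (simp add: power2_norm_eq_inner)
    also have "\<dots> \<le> (\<integral>w. C\<^sup>2 \<partial>W)"
      using bound if2 by (intro integral_mono_AE) (auto elim!: eventually_mono intro: power_mono)
    finally show ?thesis by (simp add: W.prob_space)
  qed
  have inthh: "integrable V (\<lambda>w. h (w i) \<bullet> h (w j))" if "i < L" "j < L" for i j
  proof (rule V.integrable_const_bound[where B="(C + norm \<mu>) * (C + norm \<mu>)"])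
    show "AE w in V. norm (h (w i) \<bullet> h (w j)) \<le> (C + norm \<mu>) * (C + norm \<mu>)"
      using hV[OF that(1)] hV[OF that(2)]
    proof eventually_elim
      case (elim w)
      have "norm (h (w i) \<bullet> h (w j)) \<le> norm (h (w i)) * norm (h (w j))"
        by (simp add: Cauchy_Schwarz_ineq2)
      also have "\<dots> \<le> (C + norm \<mu>) * (C + norm \<mu>)"
        using elim C by (intro mult_mono) auto
      finally show ?case .
    qed
    show "(\<lambda>w. h (w i) \<bullet> h (w j)) \<in> borel_measurable V" using that by measurable
  qed
  have diag: "(\<integral>w. h (w i) \<bullet> h (w i) \<partial>V) \<le> C\<^sup>2" if "i < L" for i
  proof -
    have "(\<integral>w. h (w i) \<bullet> h (w i) \<partial>V) = (\<integral>w. (norm (h w))\<^sup>2 \<partial>distr V W (\<lambda>w. w i))"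
      using that by (subst integral_distr) (auto simp: power2_norm_eq_inner)
    then show ?thesis using that Eh2 by (simp add: comp)
  qed
  have off: "(\<integral>w. h (w i) \<bullet> h (w j) \<partial>V) = 0" if "i < L" "j < L" "i \<noteq> j" for i j
  proof -
    \<comment> \<open>The inner product is expanded along \<open>Basis\<close>, and each summand is
      padded with factors 1 to a product over all \<open>L\<close> coordinates, the form in which
      the integral factors.\<close>
    define \<phi> where "\<phi> b l = (if l = i \<or> l = j then (\<lambda>w. h w \<bullet> b) else (\<lambda>_. 1))" for b l
    have int: "integrable W (\<phi> b l)" for b l
      using inth by (simp add: \<phi>_def)
    have split: "(\<Prod>l<L. t l) = t i * t j"
      if "\<And>l. l \<noteq> i \<Longrightarrow> l \<noteq> j \<Longrightarrow> t l = 1" for t :: "nat \<Rightarrow> real"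
    proof -
      have "(\<Prod>l<L. t l) = (\<Prod>l\<in>{i, j}. t l)"
        by (rule prod.mono_neutral_right) (use that \<open>i < L\<close> \<open>j < L\<close> in auto)
      then show ?thesis using \<open>i \<noteq> j\<close> by simp
    qed
    have eq: "(h (w i) \<bullet> b) * (h (w j) \<bullet> b) = (\<Prod>l<L. \<phi> b l (w l))" for b w
      by (subst split) (auto simp: \<phi>_def)
    have "(\<integral>w. h (w i) \<bullet> h (w j) \<partial>V) = (\<integral>w. (\<Sum>b\<in>Basis. \<Prod>l<L. \<phi> b l (w l)) \<partial>V)"
      by (simp add: euclidean_inner[of "h _" "h _"] flip: eq)
    also have "\<dots> = (\<Sum>b\<in>Basis. \<integral>w. (\<Prod>l<L. \<phi> b l (w l)) \<partial>V)"
      unfolding V_def by (intro Bochner_Integration.integral_sum P.product_integrable_prod int) simp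
    also have "\<dots> = (\<Sum>b\<in>Basis. \<Prod>l<L. \<integral>w. \<phi> b l w \<partial>W)"
      unfolding V_def by (intro sum.cong refl P.product_integral_prod int) simp
    also have "\<dots> = 0"
    proof (rule sum.neutral, rule)
      fix b
      have "(\<integral>w. \<phi> b i w \<partial>W) = 0"
        using inth Eh by (simp add: \<phi>_def)
      then show "(\<Prod>l<L. \<integral>w. \<phi> b l w \<partial>W) = 0" using \<open>i < L\<close> by auto
    qed
    finally show ?thesis .
  qed
  have Z: "?Z w = (1 / real L) *\<^sub>R (\<Sum>l<L. h (w l))" for w
    using L by (simp add: h_def sum_subtractf scaleR_diff_right sum_constant_scaleR)
  have Z2: "(norm (?Z w))\<^sup>2 = (1 / real L)\<^sup>2 * (\<Sum>i<L. \<Sum>j<L. h (w i) \<bullet> h (w j))" for w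
  proof -
    have "(\<Sum>l<L. h (w l)) \<bullet> (\<Sum>l<L. h (w l)) = (\<Sum>i<L. \<Sum>j<L. h (w i) \<bullet> h (w j))"
      by (simp only: inner_sum_left) (simp only: inner_sum_right)
    then show ?thesis
      unfolding Z power2_norm_eq_inner by (simp add: power2_eq_square)
  qed
  have mZ[measurable]: "?Z \<in> borel_measurable V"
    by (intro borel_measurable_diff borel_measurable_scaleR borel_measurable_sum
        measurable_compose[OF _ f] borel_measurable_const) auto
  have intZ2: "integrable V (\<lambda>w. (norm (?Z w))\<^sup>2)"
    unfolding Z2 by (intro integrable_mult_right Bochner_Integration.integrable_sum inthh) auto
  have "(\<integral>w. (norm (?Z w))\<^sup>2 \<partial>V) = (1 / real L)\<^sup>2 * (\<Sum>i<L. \<Sum>j<L. \<integral>w. h (w i) \<bullet> h (w j) \<partial>V)"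
  proof -
    have "(\<integral>w. (\<Sum>i<L. \<Sum>j<L. h (w i) \<bullet> h (w j)) \<partial>V) = (\<Sum>i<L. \<integral>w. (\<Sum>j<L. h (w i) \<bullet> h (w j)) \<partial>V)"
      by (intro Bochner_Integration.integral_sum Bochner_Integration.integrable_sum inthh) auto
    also have "\<dots> = (\<Sum>i<L. \<Sum>j<L. \<integral>w. h (w i) \<bullet> h (w j) \<partial>V)"
      by (intro sum.cong refl Bochner_Integration.integral_sum inthh) auto
    finally show ?thesis unfolding Z2 by simp
  qed
  also have "\<dots> \<le> (1 / real L)\<^sup>2 * (\<Sum>i<L. \<Sum>j<L. if j = i then C\<^sup>2 else 0)"
    by (intro mult_left_mono sum_mono) (auto simp: off diag)
  also have "\<dots> = (C / sqrt (real L))\<^sup>2"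
    using L by (simp add: power_divide power2_eq_square field_simps)
  finally have le2: "(\<integral>w. (norm (?Z w))\<^sup>2 \<partial>V) \<le> (C / sqrt (real L))\<^sup>2" .
  show intZ: "integrable V (\<lambda>w. norm (?Z w))"
    by (rule V.square_integrable_imp_integrable[OF _ intZ2]) measurable
  \<comment> \<open>Jensen's inequality for the square, as nonnegativity of the variance of the
    norm.\<close>
  have "(\<integral>w. norm (?Z w) \<partial>V)\<^sup>2 \<le> (\<integral>w. (norm (?Z w))\<^sup>2 \<partial>V)"
    using V.variance_positive[of "\<lambda>w. norm (?Z w)"] V.variance_eq[OF intZ intZ2] by simp
  with le2 have "(\<integral>w. norm (?Z w) \<partial>V)\<^sup>2 \<le> (C / sqrt (real L))\<^sup>2" by linarith
  then show "(\<integral>w. norm (?Z w) \<partial>V) \<le> C / sqrt (real L)"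
    by (rule power2_le_imp_le) (use C in simp)
qed

subsection \<open>The selected projections\<close>

text \<open>A finite nonempty set of values has a minimum, so \<open>LEAST\<close> ranges over an
  inhabited predicate and is not an unspecified number.\<close>

lemma Least_argmin_less:
  fixes f :: "nat \<Rightarrow> 'a::linorder"
  assumes "0 < M"
  shows "(LEAST m. m < M \<and> (\<forall>m'<M. f m \<le> f m')) < M"
proof -
  obtain m where "m < M" "\<forall>m'<M. f m \<le> f m'"
    using ex_min_if_finite[of "f ` {..<M}"] assms by (auto simp: not_less)
  then have "\<exists>m. m < M \<and> (\<forall>m'<M. f m \<le> f m')" by blast
  then show ?thesis by (rule LeastI2_ex) simp
qed

lemma Pstar_selects:
  assumes "0 < M"
  obtains m where "m < M" "Pstar n n1 M x y g Pm N = Pm m"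
  using Least_argmin_less[OF assms, of "\<lambda>m. resid n n1 x y g (Pm m) N"] that
  by (auto simp: Pstar_def)

text \<open>Regrouped blocks are restricted to \<open>{..<M}\<close>, whereas \<open>Pihat\<close>
  passes unrestricted functions; this reconciles the two.\<close>

lemma Pstar_cong:
  assumes "0 < M" and eq: "\<And>m. m < M \<Longrightarrow> Pm m = Pm' m"
  shows "Pstar n n1 M x y g Pm N = Pstar n n1 M x y g Pm' N"
proof -
  let ?r = "\<lambda>Pm m. resid n n1 x y g (Pm m) N"
  have Least: "(LEAST m. m < M \<and> (\<forall>m'<M. ?r Pm m \<le> ?r Pm m'))
      = (LEAST m. m < M \<and> (\<forall>m'<M. ?r Pm' m \<le> ?r Pm' m'))"
    by (rule arg_cong[where f = Least]) (use eq in auto)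
  show ?thesis
    using eq[OF Least_argmin_less[OF assms(1), of "?r Pm"]] unfolding Pstar_def Least .
qed

text \<open>Joint measurability in $(P, N)$ is not automatic because the space of all index sets $N$ is
  uncountable; but $N$ enters the residuals only through two lists of naturals, hence through a
  countable type.\<close>

lemma measurable_Pstar:
  fixes g :: "real^'d \<Rightarrow> (nat \<Rightarrow> (real^'d) \<times> real) \<Rightarrow> real"
    and x :: "nat \<Rightarrow> real^'p"
  assumes g[measurable]: "(\<lambda>(v, t). g v t) \<in> borel_measurable (borel \<Otimes>\<^sub>M PiM {..<n1} (\<lambda>_. borel))"
    and M: "0 < M" and Q: "sets Q = sets borel" and Nd: "sets Nd = UNIV"
  shows "(\<lambda>\<omega>. Pstar n n1 M x y g (fst \<omega>) (snd \<omega>)) \<in> PiM {..<M} (\<lambda>_. Q) \<Otimes>\<^sub>M Nd \<rightarrow>\<^sub>M borel"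
proof -
  define code where "code N = (sorted_list_of_set N, sorted_list_of_set ({..<n} - N))" for N :: "nat set"
  define trn where "trn c P = (\<lambda>j\<in>{..<n1}. (transpose P *v x (fst c ! j), y (fst c ! j)))"
    for c :: "nat list \<times> nat list" and P :: "real^'d^'p"
  define r where "r c P = (\<Sum>i\<in>set (snd c). (y i - g (transpose P *v x i) (trn c P))\<^sup>2)"
    for c :: "nat list \<times> nat list" and P :: "real^'d^'p"
  define sel where "sel c q = (LEAST m. m < M \<and> (\<forall>m'<M. r c (q m) \<le> r c (q m')))" for c q
  have sel_less: "sel c q < M" for c q
    unfolding sel_def by (rule Least_argmin_less[OF M])
  have Pstar: "Pstar n n1 M x y g q N = q (sel (code N) q)" for q N
    by (simp add: Pstar_def sel_def resid_def r_def trn_def code_def train_def Let_def)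
  have spaceNd: "space Nd = UNIV"
    using Nd sets_eq_imp_space_eq[of Nd "count_space UNIV"] by simp
  have "code \<in> Nd \<rightarrow>\<^sub>M count_space UNIV"
    using Nd spaceNd by (auto simp: measurable_def)
  then have code: "(\<lambda>\<omega>. code (snd \<omega>)) \<in> PiM {..<M} (\<lambda>_. Q) \<Otimes>\<^sub>M Nd \<rightarrow>\<^sub>M count_space UNIV"
    by (rule measurable_compose[OF measurable_snd])
  have [measurable]: "(\<lambda>P::real^'d^'p. transpose P *v z) \<in> borel \<rightarrow>\<^sub>M borel" for z
    unfolding matrix_vector_mult_def transpose_def
    by (intro borel_measurable_continuous_onI continuous_intros)
  have [measurable]: "trn c \<in> borel \<rightarrow>\<^sub>M PiM {..<n1} (\<lambda>_. borel)" for c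
    unfolding trn_def by (intro measurable_restrict borel_measurable_Pair) measurable
  have "(\<lambda>P. (\<lambda>(v, t). g v t) (transpose P *v x i, trn c P)) \<in> borel_measurable borel" for i c
    by measurable
  then have [measurable]: "r c \<in> borel_measurable borel" for c
    unfolding r_def by simp
  have comp: "(\<lambda>q. q m) \<in> PiM {..<M} (\<lambda>_. Q) \<rightarrow>\<^sub>M borel" if "m < M" for m
    using that measurable_component_singleton[of m "{..<M}" "\<lambda>_. Q"]
    by (simp add: measurable_cong_sets[OF refl Q])
  \<comment> \<open>\<open>measurable_Least\<close> asks for a measurable predicate at every natural
    \<open>m\<close>; extension by 0 provides a measurable residual beyond the index set of the
    product as well.\<close>
  define rM where "rM c m q = (if m < M then r c (q m) else 0)" for c m and q :: "nat \<Rightarrow> real^'d^'p"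
  have rM: "rM c m \<in> borel_measurable (PiM {..<M} (\<lambda>_. Q))" for c m
  proof (cases "m < M")
    case True
    have "(\<lambda>q. r c (q m)) \<in> borel_measurable (PiM {..<M} (\<lambda>_. Q))"
      by (rule measurable_compose[OF comp[OF True]]) measurable
    with True show ?thesis by (simp add: rM_def[abs_def])
  qed (simp add: rM_def[abs_def])
  \<comment> \<open>For a fixed code the selection picks one of finitely many measurable coordinates
    by a measurable index.\<close>
  have "(\<lambda>q. q (sel c q)) \<in> PiM {..<M} (\<lambda>_. Q) \<rightarrow>\<^sub>M borel" for c
  proof (rule measurable_compose_countable'[where I = "{..<M}"])
    have "Measurable.pred (PiM {..<M} (\<lambda>_. Q)) (\<lambda>q. rM c m q \<le> rM c m' q)" for m m'
      unfolding pred_def by (rule borel_measurable_le[OF rM rM])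
    then have pred: "Measurable.pred (PiM {..<M} (\<lambda>_. Q))
        (\<lambda>q. m < M \<and> (\<forall>m'\<in>{..<M}. rM c m q \<le> rM c m' q))" for m
      by (intro pred_intros_logic(3) pred_intros_finite(3)) simp_all
    have eq: "(\<lambda>q. m < M \<and> (\<forall>m'\<in>{..<M}. rM c m q \<le> rM c m' q))
        = (\<lambda>q. m < M \<and> (\<forall>m'<M. r c (q m) \<le> r c (q m')))" for m
      by (auto simp: rM_def fun_eq_iff)
    have "Measurable.pred (PiM {..<M} (\<lambda>_. Q))
        (\<lambda>q. m < M \<and> (\<forall>m'<M. r c (q m) \<le> r c (q m')))" for m
      using pred unfolding eq .
    then have "sel c \<in> PiM {..<M} (\<lambda>_. Q) \<rightarrow>\<^sub>M count_space UNIV"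
      unfolding sel_def by (rule measurable_Least)
    then show "sel c \<in> PiM {..<M} (\<lambda>_. Q) \<rightarrow>\<^sub>M count_space {..<M}"
      by (rule measurable_count_space_extend[OF subset_UNIV, rotated]) (simp add: sel_less)
  qed (auto intro: comp)
  then show ?thesis
    unfolding Pstar
    by (intro measurable_compose_countable[OF _ code, of "\<lambda>c \<omega>. fst \<omega> (sel c (fst \<omega>))"]
        measurable_compose[OF measurable_fst])
qed

lemma continuous_on_mult_transpose_self: "continuous_on S (\<lambda>P::real^'n^'m. P ** transpose P)"
  unfolding matrix_matrix_mult_def transpose_def by (intro continuous_intros)

lemma Pihat_symmetric: "transpose (Pihat n n1 L M x y g Ps Ns) = Pihat n n1 L M x y g Ps Ns"
  by (simp add: Pihat_def Let_def transpose_def matrix_matrix_mult_def vec_eq_iff sum_component mult.commute)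

text \<open>The theorem's hypothesis on \<open>svdU\<close> speaks of symmetric positive
  semidefinite matrices, and \<open>Pihat\<close> has to be one. A quadratic form is the pairing
  with the matrix v v^T, hence linear in the matrix and compatible with averaging.\<close>

lemma Pihat_nonneg:
  fixes v :: "real^'p" and Ps :: "nat \<times> nat \<Rightarrow> real^'d^'p"
  shows "0 \<le> v \<bullet> (Pihat n n1 L M x y g Ps Ns *v v)"
proof -
  define V :: "real^'p^'p" where "V = (\<chi> i j. v $ i * v $ j)"
  have V: "v \<bullet> (A *v v) = A \<bullet> V" for A
    by (simp add: V_def inner_vec_def matrix_vector_mult_def sum_distrib_left mult_ac)
  have psd: "0 \<le> (P ** transpose P) \<bullet> V" for P :: "real^'d^'p"
  proof -
    have "v \<bullet> ((P ** transpose P) *v v) = (transpose P *v v) \<bullet> (transpose P *v v)"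
      by (metis dot_lmul_matrix matrix_vector_mul_assoc transpose_matrix_vector)
    then show ?thesis by (metis V inner_ge_zero)
  qed
  show ?thesis
    unfolding V Pihat_def Let_def inner_scaleR_left inner_sum_left
    by (intro mult_nonneg_nonneg sum_nonneg psd) simp
qed

lemma norm_Pstar_mult_transpose_le:
  fixes q :: "nat \<Rightarrow> real^'d^'p"
  assumes "0 < M" and "\<And>m. m < M \<Longrightarrow> q m \<in> Qpd"
  shows "norm (Pstar n n1 M x y g q N ** transpose (Pstar n n1 M x y g q N)) \<le> real CARD('d)"
proof -
  obtain m where "m < M" "Pstar n n1 M x y g q N = q m"
    using Pstar_selects[OF assms(1)] .
  then show ?thesis
    using norm_mult_transpose_self_le[of "q m"] Qpd_norm[OF assms(2)] by simp
qed

text \<open>Singular bases are not unique, so \<open>svdU\<close> and \<open>svdD\<close> are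
  arbitrary functions returning some valid decomposition, and the bound covers every choice.
  \<open>PiInf\<close> is an integral over a single block, which makes its independence of l
  evident.\<close>

theorem theorem1:
  fixes n n1 L M :: nat
    and x :: "nat \<Rightarrow> (real, 'p::{finite,linorder}) vec" and y :: "nat \<Rightarrow> real"
    and Q :: "((real, 'd::finite) vec, 'p) vec measure"
    and g :: "(real, 'd) vec \<Rightarrow> (nat \<Rightarrow> (real, 'd) vec \<times> real) \<Rightarrow> real"
    and A0 :: "((real, 'd0::{finite,linorder}) vec, 'p) vec"
    and svdU svdD :: "((real, 'p) vec, 'p) vec \<Rightarrow> ((real, 'p) vec, 'p) vec"
  assumes "CARD('d) \<le> CARD('p)" and "CARD('d0) \<le> CARD('p)"
    and "0 < L" and "0 < M" and "0 < n" and "0 < n1" and "n1 \<le> n - 1"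
    and "prob_space Q" and "sets Q = sets borel" and "emeasure Q Qpd = 1"
    and "(\<lambda>(v, t). g v t) \<in> borel_measurable (borel \<Otimes>\<^sub>M PiM {..<n1} (\<lambda>_. borel))"
    and "transpose A0 ** A0 = mat 1"
    and "\<And>S. transpose S = S \<Longrightarrow> (\<forall>v. 0 \<le> v \<bullet> (S *v v)) \<Longrightarrow> is_svd S (svdU S) (svdD S)"
  shows
    "(let Nd = measure_pmf (pmf_of_set (subsamples n n1));
          \<Omega> = PiM ({..<L} \<times> {..<M}) (\<lambda>_. Q) \<Otimes>\<^sub>M PiM {..<L} (\<lambda>_. Nd);
          PiInf = (\<integral>\<omega>. (let P = Pstar n n1 M x y g (fst \<omega>) (snd \<omega>) in P ** transpose P)
                     \<partial>(PiM {..<M} (\<lambda>_. Q) \<Otimes>\<^sub>M Nd));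
          Ahat = (\<lambda>\<omega>. firstcols (svdU (Pihat n n1 L M x y g (fst \<omega>) (snd \<omega>))) :: ((real, 'd0) vec, 'p) vec)
      in (\<integral>\<omega>. dF (Ahat \<omega>) A0 \<partial>\<Omega>)
         \<le> 2 * sqrt (real CARD('d0)) * opnorm (PiInf - A0 ** transpose A0)
           + 2 * sqrt (real CARD('d0)) * sqrt (2 * pi) * real CARD('p) / sqrt (real L))"
proof -
  define Nd where "Nd = measure_pmf (pmf_of_set (subsamples n n1))"
  define \<Omega> where "\<Omega> = PiM ({..<L} \<times> {..<M}) (\<lambda>_. Q) \<Otimes>\<^sub>M PiM {..<L} (\<lambda>_. Nd)"
  define W where "W = PiM {..<M} (\<lambda>_. Q) \<Otimes>\<^sub>M Nd"
  define \<phi> where "\<phi> \<omega> = (let P = Pstar n n1 M x y g (fst \<omega>) (snd \<omega>) in P ** transpose P)" for \<omega>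
  define \<mu> where "\<mu> = (\<integral>\<omega>. \<phi> \<omega> \<partial>W)"
  define S where "S \<omega> = Pihat n n1 L M x y g (fst \<omega>) (snd \<omega>)"
    for \<omega> :: "(nat \<times> nat \<Rightarrow> ((real, 'd) vec, 'p) vec) \<times> (nat \<Rightarrow> nat set)"
  define \<delta> where "\<delta> \<omega> = dF (firstcols (svdU (S \<omega>)) :: ((real, 'd0) vec, 'p) vec) A0" for \<omega>
  define T where "T \<omega> = (\<lambda>l\<in>{..<L}. (\<lambda>m\<in>{..<M}. fst \<omega> (l, m), snd \<omega> l))"
    for \<omega> :: "(nat \<times> nat \<Rightarrow> ((real, 'd) vec, 'p) vec) \<times> (nat \<Rightarrow> nat set)"
  define Z where "Z w = norm ((1 / real L) *\<^sub>R (\<Sum>l<L. \<phi> (w l)) - \<mu>)" for w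
  let ?V = "PiM {..<L} (\<lambda>_. W)"
  let ?c = "2 * sqrt (real CARD('d0))" and ?b = "opnorm (\<mu> - A0 ** transpose A0)"
  note L = assms(3) and M = assms(4)
  interpret Q: prob_space Q by fact
  interpret Nd: prob_space Nd unfolding Nd_def by (rule prob_space_measure_pmf)
  interpret QM: prob_space "PiM {..<M} (\<lambda>_. Q)" by (intro prob_space_PiM Q.prob_space_axioms)
  interpret QLM: prob_space "PiM ({..<L} \<times> {..<M}) (\<lambda>_. Q)" by (intro prob_space_PiM Q.prob_space_axioms)
  interpret NL: prob_space "PiM {..<L} (\<lambda>_. Nd)" by (intro prob_space_PiM Nd.prob_space_axioms)
  interpret W': pair_prob_space "PiM {..<M} (\<lambda>_. Q)" Nd ..
  interpret \<Omega>': pair_prob_space "PiM ({..<L} \<times> {..<M}) (\<lambda>_. Q)" "PiM {..<L} (\<lambda>_. Nd)" ..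
  have W: "prob_space W" unfolding W_def by (rule W'.prob_space_axioms)
  interpret \<Omega>: prob_space \<Omega> unfolding \<Omega>_def by (rule \<Omega>'.prob_space_axioms)
  have T: "T \<in> \<Omega> \<rightarrow>\<^sub>M ?V" and dist: "distr \<Omega> ?V T = ?V"
    using distr_PiM_blocks[OF Q.prob_space_axioms Nd.prob_space_axioms, of "{..<L}" "{..<M}"]
    unfolding \<Omega>_def W_def T_def[abs_def] by simp_all
  have "(\<lambda>\<omega>. Pstar n n1 M x y g (fst \<omega>) (snd \<omega>)) \<in> W \<rightarrow>\<^sub>M borel"
    unfolding W_def by (rule measurable_Pstar) (use assms M in \<open>simp_all add: Nd_def\<close>)
  then have \<phi>: "\<phi> \<in> borel_measurable W"
    unfolding \<phi>_def[abs_def] Let_def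
    by (rule measurable_compose[OF _ borel_measurable_continuous_onI[OF continuous_on_mult_transpose_self]])
  \<comment> \<open>Membership in \<open>Qpd\<close> is only almost sure; it passes to all of the
    finitely many coordinates of a block and then through the first marginal of
    \<open>W\<close>.\<close>
  have "AE P in Q. P \<in> Qpd"
    using assms(10) by (intro Q.AE_prob_1) (simp add: Q.emeasure_eq_measure)
  then have "AE q in PiM {..<M} (\<lambda>_. Q). \<forall>m\<in>{..<M}. q m \<in> Qpd"
    by (intro AE_finite_allI AE_PiM_component Q.prob_space_axioms) simp_all
  then have "AE w in W. \<forall>m\<in>{..<M}. fst w m \<in> Qpd"
    using AE_distrD[OF measurable_fst[of "PiM {..<M} (\<lambda>_. Q)" Nd]]
    unfolding W_def Nd.distr_pair_fst by blast
  then have bound: "AE w in W. norm (\<phi> w) \<le> real CARD('d)"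
    by eventually_elim (simp add: \<phi>_def Let_def norm_Pstar_mult_transpose_le[OF M])
  have intZ: "integrable ?V Z" and EZ: "(\<integral>w. Z w \<partial>?V) \<le> real CARD('d) / sqrt (real L)"
    using expected_norm_mean_deviation_le[OF W \<phi> bound L] unfolding Z_def[abs_def] \<mu>_def by simp_all
  have intZT: "integrable \<Omega> (\<lambda>\<omega>. Z (T \<omega>))"
    using integrable_distr[OF T] intZ by (simp add: dist)
  have "(\<integral>\<omega>. Z (T \<omega>) \<partial>\<Omega>) = (\<integral>w. Z w \<partial>?V)"
    using integral_distr[OF T borel_measurable_integrable[OF intZ]] by (simp add: dist)
  also note EZ
  also have "real CARD('d) / sqrt (real L) \<le> sqrt (2 * pi) * real CARD('p) / sqrt (real L)"
  proof -
    have "1 \<le> sqrt (2 * pi)" using pi_gt3 by simp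
    then have "real CARD('d) \<le> sqrt (2 * pi) * real CARD('p)"
      using assms(1) mult_mono[of 1 "sqrt (2 * pi)" "real CARD('d)" "real CARD('p)"] by simp
    then show ?thesis by (rule divide_right_mono) simp
  qed
  finally have EZT: "(\<integral>\<omega>. Z (T \<omega>) \<partial>\<Omega>) \<le> sqrt (2 * pi) * real CARD('p) / sqrt (real L)" .
  have ZT: "Z (T \<omega>) = norm (S \<omega> - \<mu>)" for \<omega>
  proof -
    have "\<phi> (T \<omega> l) = (let P = Pstar n n1 M x y g (\<lambda>m. fst \<omega> (l, m)) (snd \<omega> l) in P ** transpose P)"
      if "l < L" for l
      using that Pstar_cong[OF M, of "\<lambda>m\<in>{..<M}. fst \<omega> (l, m)" "\<lambda>m. fst \<omega> (l, m)" n n1 x y g "snd \<omega> l"]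
      by (simp add: \<phi>_def T_def)
    then show ?thesis by (simp add: Z_def S_def Pihat_def)
  qed
  \<comment> \<open>The mean \<open>\<mu>\<close> is inserted between \<open>S \<omega>\<close> and
    the target projection. The fluctuation is relaxed to the Frobenius norm, where the inner product
    makes the variance computation available.\<close>
  have pointwise: "\<delta> \<omega> \<le> ?c * (?b + Z (T \<omega>))" for \<omega>
  proof -
    have "is_svd (S \<omega>) (svdU (S \<omega>)) (svdD (S \<omega>))"
      unfolding S_def by (intro assms(13) Pihat_symmetric allI Pihat_nonneg)
    note opt = firstcols_svd[OF assms(2) this assms(12) refl]
    have "\<delta> \<omega> \<le> ?c * opnorm (S \<omega> - A0 ** transpose A0)"
      unfolding \<delta>_def
      by (rule projection_distance_le[OF opt(1) assms(12) _ opt(2)]) (simp add: S_def Pihat_symmetric)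
    also have "opnorm (S \<omega> - A0 ** transpose A0) \<le> ?b + opnorm (S \<omega> - \<mu>)"
      using opnorm_triangle[of "\<mu> - A0 ** transpose A0" "S \<omega> - \<mu>"] by simp
    also have "opnorm (S \<omega> - \<mu>) \<le> Z (T \<omega>)"
      unfolding ZT by (rule opnorm_le_norm)
    finally show ?thesis by (simp add: mult_left_mono)
  qed
  have "(\<integral>\<omega>. \<delta> \<omega> \<partial>\<Omega>) \<le> ?c * (?b + sqrt (2 * pi) * real CARD('p) / sqrt (real L))"
  proof (cases "integrable \<Omega> \<delta>")
    case True
    have "(\<integral>\<omega>. \<delta> \<omega> \<partial>\<Omega>) \<le> (\<integral>\<omega>. ?c * (?b + Z (T \<omega>)) \<partial>\<Omega>)"
      by (rule integral_mono[OF True _ pointwise]) (simp add: intZT)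
    also have "\<dots> = ?c * (?b + (\<integral>\<omega>. Z (T \<omega>) \<partial>\<Omega>))"
      using intZT by (simp add: \<Omega>.prob_space)
    also have "\<dots> \<le> ?c * (?b + sqrt (2 * pi) * real CARD('p) / sqrt (real L))"
      using EZT by (intro mult_left_mono add_left_mono) simp_all
    finally show ?thesis .
  next
    case False \<comment> \<open>\<open>svdU\<close> need not be measurable; the Bochner integral is then 0.\<close>
    then show ?thesis by (simp add: not_integrable_integral_eq opnorm_nonneg)
  qed
  then show ?thesis
    unfolding \<delta>_def S_def \<mu>_def \<phi>_def W_def \<Omega>_def Nd_def Let_def
    by (simp add: distrib_left mult.assoc)
qed

end
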